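(* The generating function $S(x,0)$ whose coefficient of $x^n$ is the number of packing paths with $n$ steps (i.e. paths with $n$ steps ending on the $x$-axis) satisfies $$S(x,0)=\frac{1-x-\sqrt{(1-x)(1-2x)(1+x+2x^2)}}{2x^3}.$$ Moreover, $[x^0]S(x,0)=1$ and $$[x^n]S(x,0)=\sum_{k=0}^{\lfloor n/3\rfloor}\frac1{k+1}\binom{2k}{k}\binom{n-2k-1}{n-3k}\qquad\text{for } n\ge0.$$ As $n\to\infty$, $[x^n]S(x,0)\sim\dfrac{2^{n+1}}{\sqrt\pi\,n^{3/2}}$.
   Context: Consider the hexagonal packing of the plane by circles of radius $2$ with centers $(2+4i+2j,\,2\sqrt3\,j)$, $i,j\in\mathbb Z$; the origin is the tangency point of two horizontally adjacent circles. The tangency points cut every circle into six arcs. Traversed from left to right these give six types of steps (angles measured on the circle carrying the arc): $U$ from $180^\circ$ to $120^\circ$ (displacement $(1,\sqrt3)$), $F$ from $120^\circ$ to $60^\circ$ (displacement $(2,0)$), $D$ from $60^\circ$ to $0^\circ$ (displacement $(1,-\sqrt3)$), $\overline U$ from $300^\circ$ to $360^\circ$ (displacement $(1,\sqrt3)$), $\overline F$ from $240^\circ$ to $300^\circ$ (displacement $(2,0)$), $\overline D$ from $180^\circ$ to $240^\circ$ (displacement $(1,-\sqrt3)$). A path in the packing starts at the origin, is a concatenation of such arcs of circles of the packing, each starting where the previous one ends, and stays in the quarter plane $x,y\ge 0$. Equivalently, it is a word in $\{U,F,D,\overline U,\overline F,\overline D\}$ whose first step (if any) is $U$, in which $U$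 or $\overline F$ can only be followed by $F$ or $\overline U$; $F$ or $\overline D$ only by $\overline F$ or $D$; $\overline U$ or $D$ only by $U$ or $\overline D$; and which never goes below ordinate $0$. A packing path is such a path ending on the $x$-axis. The empty path is allowed. The number of steps of a path is its number of arcs. The square root is the formal power series with constant term $1$; $\binom{-1}{0}=1$; $a_n\sim b_n$ means $a_n/b_n\to1$. *)

theory Defs
  imports
    "HOL-Complex_Analysis.Complex_Analysis"
    "HOL-Computational_Algebra.Computational_Algebra"
    "HOL-Library.Landau_Symbols"
begin

text \<open>The plane is identified with the type of complex numbers.\<close>

definition circle_center :: "int \<Rightarrow> int \<Rightarrow> complex" where
  "circle_center i j = Complex (2 + 4 * of_int i + 2 * of_int j) (2 * sqrt 3 * of_int j)"

text \<open>The suffix \<open>_bar\<close> stands for an overline.\<close>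

datatype step = U | F | D | U_bar | F_bar | D_bar

fun start_angle :: "step \<Rightarrow> real" where
  "start_angle U = pi"
| "start_angle F = 2 * pi / 3"
| "start_angle D = pi / 3"
| "start_angle U_bar = 5 * pi / 3"
| "start_angle F_bar = 4 * pi / 3"
| "start_angle D_bar = pi"

fun end_angle :: "step \<Rightarrow> real" where
  "end_angle U = 2 * pi / 3"
| "end_angle F = pi / 3"
| "end_angle D = 0"
| "end_angle U_bar = 2 * pi"
| "end_angle F_bar = 5 * pi / 3"
| "end_angle D_bar = 4 * pi / 3"

text \<open>\<open>Packing_Arc i j s\<close> is the arc of type \<open>s\<close> on the circle centred at
  \<open>circle_center i j\<close>. Different triples \<open>(i, j, s)\<close> denote different arcs of the plane,
  so counting lists of triples is the same as counting sequences of arcs.\<close>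

datatype packing_arc = Packing_Arc int int step

fun arc_path :: "packing_arc \<Rightarrow> real \<Rightarrow> complex" where
  "arc_path (Packing_Arc i j s) =
     part_circlepath (circle_center i j) 2 (start_angle s) (end_angle s)"

definition quarter_plane :: "complex set" where
  "quarter_plane = {z. 0 \<le> Re z \<and> 0 \<le> Im z}"

definition path_in_packing :: "packing_arc list \<Rightarrow> bool" where
  "path_in_packing p \<longleftrightarrow>
     (p \<noteq> [] \<longrightarrow> pathstart (arc_path (hd p)) = 0) \<and>
     successively (\<lambda>a b. pathfinish (arc_path a) = pathstart (arc_path b)) p \<and>
     (\<forall>a\<in>set p. path_image (arc_path a) \<subseteq> quarter_plane)"

definition end_point :: "packing_arc list \<Rightarrow> complex" where
  "end_point p = (if p = [] then 0 else pathfinish (arc_path (last p)))"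

definition packing_path :: "packing_arc list \<Rightarrow> bool" where
  "packing_path p \<longleftrightarrow> path_in_packing p \<and> Im (end_point p) = 0"

definition packing_gf :: "real fps" where
  "packing_gf = Abs_fps (\<lambda>n. real (card {p. packing_path p \<and> length p = n}))"

text \<open>For a series with constant term \<open>1\<close>, \<open>fps_radical root 2\<close> is the square root with
  constant term \<open>root 2 1 = 1\<close>.\<close>

definition fps_sqrt :: "real fps \<Rightarrow> real fps" where
  "fps_sqrt f = fps_radical root 2 f"

end

theory Submission
  imports Defs "HOL-Real_Asymp.Real_Asymp"
begin

text \<open>
  Write \<open>S\<close> for the solution of \<open>S = 1 + x\<^sup>3 / (1 - x) S\<^sup>2\<close>, the Catalan series evaluated at
  \<open>x\<^sup>3 / (1 - x)\<close>. A path in the packing is determined by its successive end points, and at a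
  tangency point there are at most two ways to continue; this yields a linear recurrence for the
  number of paths from a given point down to the axis. The recurrence depends only on the row of
  circles and on the position of the point on its circle, and it is solved by \<open>T^m S\<close>,
  \<open>T^m (S - 1) / x\<close> and \<open>T^m (S - 1 + x S)\<close> with \<open>T = x (S - 1 + x S)\<close>, the generating
  function of first passages from one row to the next lower one.

  For the asymptotics, \<open>1 - x - 2 x\<^sup>3 S\<close> is the product of \<open>sqrt (1 - 2 x)\<close>, whose
  coefficients are known, and a series \<open>V\<close> with radius of convergence greater than \<open>1 / 2\<close>.
  By dominated convergence the coefficients of the product are asymptotic to \<open>V(1/2)\<close> times those
  of \<open>sqrt (1 - 2 x)\<close>. Here \<open>V(1/2)\<^sup>2 = 1\<close>, and the sign is determined by the
  nonnegativity of the numbers of paths.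
\<close>

section \<open>Arcs and tangency points\<close>

text \<open>With these coordinates every tangency point has integer entries, so asking which arcs
  start at a given point becomes linear integer arithmetic.\<close>

definition lattice_point :: "int \<Rightarrow> int \<Rightarrow> complex" where
  "lattice_point a b = Complex (of_int a) (sqrt 3 * of_int b)"

lemma lattice_point_eq_iff [simp]:
  "lattice_point a b = lattice_point c d \<longleftrightarrow> a = c \<and> b = d"
  by (simp add: lattice_point_def)

text \<open>Offsets of the end points of an arc, in units of \<open>(1, sqrt 3)\<close>, relative to the leftmost
  point of its circle.\<close>

fun start_offset :: "step \<Rightarrow> int \<times> int" where
  "start_offset U = (0, 0)"
| "start_offset F = (1, 1)"
| "start_offset D = (3, 1)"
| "start_offset U_bar = (3, -1)"
| "start_offset F_bar = (1, -1)"
| "start_offset D_bar = (0, 0)"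

fun end_offset :: "step \<Rightarrow> int \<times> int" where
  "end_offset U = (1, 1)"
| "end_offset F = (3, 1)"
| "end_offset D = (4, 0)"
| "end_offset U_bar = (4, 0)"
| "end_offset F_bar = (3, -1)"
| "end_offset D_bar = (1, -1)"

lemma sin_cos_240: "cos (pi * 4 / 3) = - 1 / 2" "sin (pi * 4 / 3) = - sqrt 3 / 2"
  using cos_periodic_pi[of "pi / 3"] sin_periodic_pi[of "pi / 3"]
  by (simp_all add: cos_60 sin_60 field_simps)

lemma sin_cos_300: "cos (pi * 5 / 3) = 1 / 2" "sin (pi * 5 / 3) = - sqrt 3 / 2"
  using cos_2pi_minus[of "pi / 3"] sin_2pi_minus[of "pi / 3"]
  by (simp_all add: cos_60 sin_60 field_simps)

lemma pathstart_arc_path: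
  "pathstart (arc_path (Packing_Arc i j s)) =
     lattice_point (4 * i + 2 * j + fst (start_offset s)) (2 * j + snd (start_offset s))"
proof -
  have "pathstart (arc_path (Packing_Arc i j s)) = circle_center i j + 2 * cis (start_angle s)"
    by (simp add: cis_conv_exp)
  thus ?thesis
    by (cases s)
       (simp_all add: circle_center_def lattice_point_def complex_eq_iff
          cos_60 sin_60 cos_120' sin_120' sin_cos_240 sin_cos_300 algebra_simps)
qed

lemma pathfinish_arc_path:
  "pathfinish (arc_path (Packing_Arc i j s)) =
     lattice_point (4 * i + 2 * j + fst (end_offset s)) (2 * j + snd (end_offset s))"
proof -
  have "pathfinish (arc_path (Packing_Arc i j s)) = circle_center i j + 2 * cis (end_angle s)"
    by (simp add: cis_conv_exp)
  thus ?thesis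
    by (cases s)
       (simp_all add: circle_center_def lattice_point_def complex_eq_iff
          cos_60 sin_60 cos_120' sin_120' sin_cos_240 sin_cos_300 algebra_simps)
qed

section \<open>Arcs inside the quarter plane\<close>

lemma arc_path_image:
  "path_image (arc_path (Packing_Arc i j s)) =
     (\<lambda>t. circle_center i j + 2 * cis t) ` closed_segment (start_angle s) (end_angle s)"
  by (simp add: path_image_part_circlepath')

text \<open>The centre has abscissa at least \<open>2\<close>, the radius, so the whole circle
  satisfies \<open>x \<ge> 0\<close>. The arc lies on the upper half of the circle, which makes row
  \<open>0\<close> admissible.\<close>

lemma arc_in_quarter_plane_U:
  assumes "0 \<le> 4 * i + 2 * j" "0 \<le> j"
  shows "path_image (arc_path (Packing_Arc i j U)) \<subseteq> quarter_plane"
proof -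
  have x: "0 \<le> 4 * real_of_int i + 2 * real_of_int j" "0 \<le> real_of_int j"
    using assms by linarith+
  have "0 \<le> sin t" if "t \<in> closed_segment pi (2 * pi / 3)" for t
    using that by (intro sin_ge_zero) (auto simp: closed_segment_eq_real_ivl split: if_splits)
  moreover have "0 \<le> Re (circle_center i j + 2 * cis t)" for t
    using x cos_ge_minus_one[of t] by (simp add: circle_center_def, linarith)
  ultimately show ?thesis
    using x unfolding arc_path_image quarter_plane_def
    by (auto simp: circle_center_def intro!: add_nonneg_nonneg)
qed

text \<open>In row \<open>1\<close> and above, the centre has height at least
  \<open>2 * sqrt 3\<close>, which exceeds the radius.\<close>

lemma circle_above_axis: "1 \<le> j \<Longrightarrow> 0 \<le> Im (circle_center i j + 2 * cis t)"
proof -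
  assume "1 \<le> j"
  hence "1 \<le> real_of_int j" by simp
  moreover have "1 \<le> sqrt 3" by simp
  ultimately have "1 * 1 \<le> sqrt 3 * real_of_int j" by (intro mult_mono) auto
  thus ?thesis using sin_ge_minus_one[of t] by (simp add: circle_center_def, linarith)
qed

lemma arc_in_quarter_plane_upper:
  assumes "0 \<le> 4 * i + 2 * j" "1 \<le> j"
  shows "path_image (arc_path (Packing_Arc i j s)) \<subseteq> quarter_plane"
proof -
  have x: "0 \<le> 4 * real_of_int i + 2 * real_of_int j"
    using assms by linarith
  have "0 \<le> Re (circle_center i j + 2 * cis t)" for t
    using x cos_ge_minus_one[of t] by (simp add: circle_center_def, linarith)
  thus ?thesis
    unfolding arc_path_image quarter_plane_def using circle_above_axis[OF assms(2)] by auto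
qed

lemma arc_in_quarter_plane_F:
  assumes "0 \<le> 4 * i + 2 * j" "0 \<le> j"
  shows "path_image (arc_path (Packing_Arc i j F)) \<subseteq> quarter_plane"
proof -
  have x: "0 \<le> 4 * real_of_int i + 2 * real_of_int j" "0 \<le> real_of_int j"
    using assms by linarith+
  have "0 \<le> sin t" if "t \<in> closed_segment (2 * pi / 3) (pi / 3)" for t
    using that by (intro sin_ge_zero) (auto simp: closed_segment_eq_real_ivl split: if_splits)
  moreover have "0 \<le> Re (circle_center i j + 2 * cis t)" for t
    using x cos_ge_minus_one[of t] by (simp add: circle_center_def, linarith)
  ultimately show ?thesis
    using x unfolding arc_path_image quarter_plane_def
    by (auto simp: circle_center_def intro!: add_nonneg_nonneg)
qed

text \<open>The bound allows a circle centred on the y-axis: only its right half stays in the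
  region, and the arc lies there because \<open>cos t \<ge> 0\<close>.\<close>

lemma arc_in_quarter_plane_D:
  assumes "0 \<le> 2 + 4 * i + 2 * j" "0 \<le> j"
  shows "path_image (arc_path (Packing_Arc i j D)) \<subseteq> quarter_plane"
proof -
  have x: "0 \<le> 2 + 4 * real_of_int i + 2 * real_of_int j" "0 \<le> real_of_int j"
    using assms by linarith+
  have "0 \<le> sin t" "0 \<le> cos t" if "t \<in> closed_segment (pi / 3) 0" for t
    using that by (intro sin_ge_zero cos_ge_zero; auto simp: closed_segment_eq_real_ivl split: if_splits)+
  thus ?thesis
    using x unfolding arc_path_image quarter_plane_def
    by (auto simp: circle_center_def intro!: add_nonneg_nonneg)
qed

lemma arc_in_quarter_plane_U_bar:
  assumes "0 \<le> 2 + 4 * i + 2 * j" "1 \<le> j"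
  shows "path_image (arc_path (Packing_Arc i j U_bar)) \<subseteq> quarter_plane"
proof -
  have x: "0 \<le> 2 + 4 * real_of_int i + 2 * real_of_int j"
    using assms by linarith
  have "0 \<le> cos t" if "t \<in> closed_segment (5 * pi / 3) (2 * pi)" for t
    using that cos_2pi_minus[of t] cos_ge_zero[of "2 * pi - t"]
    by (auto simp: closed_segment_eq_real_ivl split: if_splits)
  hence "0 \<le> Re (circle_center i j + 2 * cis t)" if "t \<in> closed_segment (5 * pi / 3) (2 * pi)" for t
    using x that by (simp add: circle_center_def)
  thus ?thesis
    unfolding arc_path_image quarter_plane_def using circle_above_axis[OF assms(2)] by auto
qed

text \<open>The end point already has negative ordinate \<open>sqrt 3 * (2 * j - 1)\<close>.\<close>

lemma arc_D_bar_not_in_quarter_plane: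
  assumes "j \<le> 0"
  shows "\<not> path_image (arc_path (Packing_Arc i j D_bar)) \<subseteq> quarter_plane"
proof
  assume "path_image (arc_path (Packing_Arc i j D_bar)) \<subseteq> quarter_plane"
  hence "pathfinish (arc_path (Packing_Arc i j D_bar)) \<in> quarter_plane"
    by (auto simp: pathfinish_in_path_image)
  hence "0 \<le> sqrt 3 * real_of_int (2 * j - 1)"
    unfolding pathfinish_arc_path by (simp add: quarter_plane_def lattice_point_def)
  hence "0 \<le> real_of_int (2 * j - 1)"
    by (simp only: zero_le_mult_iff) auto
  thus False using assms by linarith
qed

section \<open>Paths to the axis from an arbitrary point, split at the first arc\<close>

definition paths_to_axis :: "nat \<Rightarrow> complex \<Rightarrow> packing_arc list set" where
  "paths_to_axis n z = {p. length p = n \<and> (p \<noteq> [] \<longrightarrow> pathstart (arc_path (hd p)) = z) \<and>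
     successively (\<lambda>a b. pathfinish (arc_path a) = pathstart (arc_path b)) p \<and>
     (\<forall>a\<in>set p. path_image (arc_path a) \<subseteq> quarter_plane) \<and>
     Im (if p = [] then z else pathfinish (arc_path (last p))) = 0}"

lemma packing_paths_eq: "{p. packing_path p \<and> length p = n} = paths_to_axis n 0"
  by (auto simp: paths_to_axis_def packing_path_def path_in_packing_def end_point_def)

lemma paths_to_axis_0: "paths_to_axis 0 z = (if Im z = 0 then {[]} else {})"
  by (auto simp: paths_to_axis_def)

definition next_arcs :: "complex \<Rightarrow> packing_arc set" where
  "next_arcs z = {a. pathstart (arc_path a) = z \<and> path_image (arc_path a) \<subseteq> quarter_plane}"

lemma paths_to_axis_Suc:
  "paths_to_axis (Suc n) z =
     (\<Union>a\<in>next_arcs z. (#) a ` paths_to_axis n (pathfinish (arc_path a)))"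
proof -
  have "p \<in> paths_to_axis (Suc n) z \<longleftrightarrow>
        p \<in> (\<Union>a\<in>next_arcs z. (#) a ` paths_to_axis n (pathfinish (arc_path a)))" for p
  proof (cases p)
    case (Cons a q)
    thus ?thesis
      by (cases q) (auto simp: paths_to_axis_def next_arcs_def)
  qed (auto simp: paths_to_axis_def)
  thus ?thesis by blast
qed

lemma next_arcs_C:
  assumes "0 \<le> 4 * i + 2 * j" "0 \<le> j"
  shows "next_arcs (lattice_point (4 * i + 2 * j) (2 * j)) =
    (if j = 0 then {Packing_Arc i j U} else {Packing_Arc i j U, Packing_Arc i j D_bar})"
proof -
  \<comment> \<open>The parity of the ordinate excludes the four steps whose start offset has odd
    second entry.\<close>
  have *: "s \<in> {U, D_bar} \<and> i' = i \<and> j' = j"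
    if "pathstart (arc_path (Packing_Arc i' j' s)) = lattice_point (4 * i + 2 * j) (2 * j)" for i' j' s
    using that unfolding pathstart_arc_path lattice_point_eq_iff
    by (cases s) (simp; presburger)+
  have "Packing_Arc i' j' s \<in> next_arcs (lattice_point (4 * i + 2 * j) (2 * j)) \<longleftrightarrow>
      i' = i \<and> j' = j \<and> (s = U \<or> s = D_bar \<and> j \<noteq> 0)" for i' j' s
    using * arc_in_quarter_plane_U[OF assms] arc_D_bar_not_in_quarter_plane[of j i]
      arc_in_quarter_plane_upper[of i j D_bar] assms
    unfolding next_arcs_def mem_Collect_eq
    by (auto simp: pathstart_arc_path simp del: arc_path.simps)
  thus ?thesis
    by (intro set_eqI, case_tac x) auto
qed

text \<open>The point at 120 degrees of circle \<open>(i, j)\<close> is the point at 300 degrees of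
  circle \<open>(i - 1, j + 1)\<close>. That circle may be centred on the y-axis, but its arc
  \<open>U_bar\<close> lies on the right half.\<close>

lemma next_arcs_A:
  assumes "0 \<le> 4 * i + 2 * j" "0 \<le> j"
  shows "next_arcs (lattice_point (4 * i + 2 * j + 1) (2 * j + 1)) =
    {Packing_Arc i j F, Packing_Arc (i - 1) (j + 1) U_bar}"
proof -
  have *: "s = F \<and> i' = i \<and> j' = j \<or> s = U_bar \<and> i' = i - 1 \<and> j' = j + 1"
    if "pathstart (arc_path (Packing_Arc i' j' s)) = lattice_point (4 * i + 2 * j + 1) (2 * j + 1)" for i' j' s
    using that unfolding pathstart_arc_path lattice_point_eq_iff
    by (cases s) (simp; presburger)+
  have "Packing_Arc i' j' s \<in> next_arcs (lattice_point (4 * i + 2 * j + 1) (2 * j + 1)) \<longleftrightarrow>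
      s = F \<and> i' = i \<and> j' = j \<or> s = U_bar \<and> i' = i - 1 \<and> j' = j + 1" for i' j' s
    using * arc_in_quarter_plane_F[OF assms] arc_in_quarter_plane_U_bar[of "i - 1" "j + 1"] assms
    unfolding next_arcs_def mem_Collect_eq
    by (auto simp: pathstart_arc_path simp del: arc_path.simps)
  thus ?thesis
    by (intro set_eqI, case_tac x) auto
qed

text \<open>The point at 60 degrees of circle \<open>(i, j)\<close> is the point at 240 degrees of
  circle \<open>(i, j + 1)\<close>. The weaker bound admits a circle \<open>(i, j)\<close> centred
  on the y-axis, which is reachable by \<open>D_bar\<close> from the row above.\<close>

lemma next_arcs_B:
  assumes "0 \<le> 2 + 4 * i + 2 * j" "0 \<le> j"
  shows "next_arcs (lattice_point (4 * i + 2 * j + 3) (2 * j + 1)) =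
    {Packing_Arc i j D, Packing_Arc i (j + 1) F_bar}"
proof -
  have *: "s = D \<and> i' = i \<and> j' = j \<or> s = F_bar \<and> i' = i \<and> j' = j + 1"
    if "pathstart (arc_path (Packing_Arc i' j' s)) = lattice_point (4 * i + 2 * j + 3) (2 * j + 1)" for i' j' s
    using that unfolding pathstart_arc_path lattice_point_eq_iff
    by (cases s) (simp; presburger)+
  have "Packing_Arc i' j' s \<in> next_arcs (lattice_point (4 * i + 2 * j + 3) (2 * j + 1)) \<longleftrightarrow>
      s = D \<and> i' = i \<and> j' = j \<or> s = F_bar \<and> i' = i \<and> j' = j + 1" for i' j' s
    using * arc_in_quarter_plane_D[OF assms] arc_in_quarter_plane_upper[of i "j + 1" F_bar] assms
    unfolding next_arcs_def mem_Collect_eq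
    by (auto simp: pathstart_arc_path simp del: arc_path.simps)
  thus ?thesis
    by (intro set_eqI, case_tac x) auto
qed

section \<open>The Catalan series at \<open>x\<^sup>3 / (1 - x)\<close>\<close>

definition catalan_fps :: "real fps" where
  "catalan_fps = Abs_fps (\<lambda>k. 1 / (real k + 1) * real ((2 * k) choose k))"

text \<open>These are the coefficients of \<open>sqrt (1 - 4 x) = 1 - 2 x C\<close> with
  \<open>C\<close> the Catalan series. Both sides satisfy
  \<open>(k + 2) c (k + 1) = 2 (2 k + 1) c k\<close>.\<close>

lemma gbinomial_half_Suc:
  "(1 / 2 gchoose Suc k) * (- 4) ^ Suc k = - 2 * (1 / (real k + 1) * real ((2 * k) choose k))"
proof (induction k)
  case (Suc k)
  have central: "real ((2 * Suc k) choose Suc k) * (real k + 1) = 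
      2 * (2 * real k + 1) * real ((2 * k) choose k)"
  proof -
    have "Suc k * ((2 * Suc k) choose Suc k) = 2 * Suc k * ((2 * k + 1) choose k)"
      using Suc_times_binomial_eq[of "2 * k + 1" k] by simp
    hence "(2 * Suc k) choose Suc k = 2 * ((2 * k + 1) choose k)"
      by (metis (no_types, lifting) mult.assoc mult.commute mult_cancel1 nat.distinct(1))
    moreover have "Suc k * ((2 * k + 1) choose k) = (2 * k + 1) * ((2 * k) choose k)"
      using Suc_times_binomial_eq[of "2 * k" k] binomial_symmetric[of k "2 * k + 1"]
        by (simp add: algebra_simps)
    ultimately have "Suc k * ((2 * Suc k) choose Suc k) = 2 * (2 * k + 1) * ((2 * k) choose k)"
      by (metis (no_types, lifting) mult.assoc mult.left_commute)
    hence "real (Suc k * ((2 * Suc k) choose Suc k)) = real (2 * (2 * k + 1) * ((2 * k) choose k))"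
      by (rule arg_cong)
    thus ?thesis by (simp add: algebra_simps)
  qed
  have step: "(real k + 2) * (1 / 2 gchoose Suc (Suc k)) = (1 / 2 - (real k + 1)) * (1 / 2 gchoose Suc k)"
    using gbinomial_mult_1[of "1 / 2 :: real" "Suc k"] by (simp add: algebra_simps)
  have "(real k + 2) * ((1 / 2 gchoose Suc (Suc k)) * (- 4) ^ Suc (Suc k)) =
      ((real k + 2) * (1 / 2 gchoose Suc (Suc k))) * ((- 4) ^ Suc k * (- 4))"
    by simp
  also have "\<dots> = 2 * (2 * real k + 1) * ((1 / 2 gchoose Suc k) * (- 4) ^ Suc k)"
    unfolding step by (simp add: algebra_simps)
  also have "\<dots> = - 2 * (2 * (2 * real k + 1) * real ((2 * k) choose k) / (real k + 1))"
    unfolding Suc.IH by simp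
  also have "\<dots> = - 2 * real ((2 * Suc k) choose Suc k)"
    unfolding central[symmetric] by (simp add: field_simps)
  finally show ?case by (simp add: field_simps)
qed simp

text \<open>An explicit square root of \<open>1 + c x\<close>, used with real and with complex
  \<open>c\<close>.\<close>

lemma fps_binomial_half_compose_square:
  fixes c :: "'a :: field_char_0"
  shows "(fps_binomial (1 / 2) oo (fps_const c * fps_X)) ^ 2 = 1 + fps_const c * fps_X"
proof -
  have "(fps_binomial (1 / 2) oo (fps_const c * fps_X)) ^ 2 =
      fps_binomial (1 / 2) ^ 2 oo (fps_const c * fps_X)"
    by (simp add: fps_compose_power)
  also have "fps_binomial (1 / 2 :: 'a) ^ 2 = 1 + fps_X"
    by (simp add: fps_binomial_power fps_binomial_1)
  finally show ?thesis by (simp add: fps_compose_add_distrib)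
qed

text \<open>Squaring \<open>sqrt (1 - 4 x) = 1 - 2 x C\<close> leaves
  \<open>4 x (1 + x C^2 - C) = 0\<close>, and \<open>4 x\<close> cancels.\<close>

lemma catalan_fps_eq: "catalan_fps = 1 + fps_X * catalan_fps ^ 2"
proof -
  have root: "fps_binomial (1 / 2) oo (fps_const (- 4) * fps_X) = 1 - 2 * fps_X * catalan_fps"
  proof (rule fps_ext)
    fix n
    show "fps_nth (fps_binomial (1 / 2) oo (fps_const (- 4) * fps_X)) n =
        fps_nth (1 - 2 * fps_X * catalan_fps) n"
    proof (cases n)
      case (Suc k)
      have "fps_nth (2 * fps_X * catalan_fps) (Suc k) = 2 * fps_nth catalan_fps k"
        by (simp add: mult.assoc numeral_fps_const)
      thus ?thesis
        using gbinomial_half_Suc[of k] unfolding fps_compose_linear Suc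
        by (simp add: catalan_fps_def mult.commute)
    qed (simp add: mult.assoc)
  qed
  have "(1 - 2 * fps_X * catalan_fps) ^ 2 = 1 - 4 * fps_X"
    using fps_binomial_half_compose_square[of "- 4 :: real"] unfolding root
    by (simp add: numeral_fps_const)
  hence "4 * fps_X * (1 + fps_X * catalan_fps ^ 2 - catalan_fps) = 0"
    by (simp add: power2_eq_square algebra_simps)
  hence "1 + fps_X * catalan_fps ^ 2 - catalan_fps = 0"
    by (simp only: mult_eq_0_iff) auto
  thus ?thesis by simp
qed

definition path_gf :: "real fps" where
  "path_gf = catalan_fps oo (fps_X ^ 3 * inverse (1 - fps_X))"

lemma path_gf_eq: "path_gf = 1 + fps_X ^ 3 * inverse (1 - fps_X) * path_gf ^ 2"
proof -
  have "path_gf = (1 + fps_X * catalan_fps ^ 2) oo (fps_X ^ 3 * inverse (1 - fps_X))"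
    unfolding path_gf_def using catalan_fps_eq by simp
  thus ?thesis
    by (simp add: fps_compose_add_distrib fps_compose_mult_distrib path_gf_def flip: fps_compose_power)
qed

lemma one_minus_X_inverse: "(1 - fps_X) * inverse (1 - fps_X) = (1 :: real fps)"
  by (rule inverse_mult_eq_1') simp

lemma path_gf_quadratic:
  "(1 - fps_X) * path_gf = (1 - fps_X) + fps_X ^ 3 * path_gf ^ 2"
proof -
  have "(1 - fps_X) * path_gf = (1 - fps_X) * (1 + fps_X ^ 3 * inverse (1 - fps_X) * path_gf ^ 2)"
    using path_gf_eq by simp
  also have "\<dots> = (1 - fps_X) + ((1 - fps_X) * inverse (1 - fps_X)) * (fps_X ^ 3 * path_gf ^ 2)"
    by (simp add: algebra_simps)
  finally show ?thesis by (simp add: one_minus_X_inverse)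
qed

text \<open>The negative binomial series. The real upper argument also covers \<open>k = 0\<close>,
  where the value is \<open>1\<close> for \<open>m = 0\<close> and \<open>0\<close>
  otherwise.\<close>

lemma fps_nth_inverse_one_minus_X_power:
  "fps_nth (inverse (1 - fps_X :: real fps) ^ k) m = (real k + real m - 1) gchoose m"
proof -
  have "inverse (1 - fps_X :: real fps) ^ k = fps_binomial (- real k) oo (- fps_const 1 * fps_X)"
    using one_minus_fps_X_const_neg_power[of "1 :: real" k] by (simp add: fps_inverse_power)
  also have "fps_nth \<dots> m = (- 1) ^ m * (- real k gchoose m)"
    by (subst fps_const_neg, subst fps_compose_linear) simp
  also have "\<dots> = (real k + real m - 1) gchoose m"
    by (subst gbinomial_minus) (simp flip: mult.assoc power_mult_distrib)
  finally show ?thesis .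
qed

text \<open>The \<open>k\<close>-th summand of the composition starts at \<open>x^(3 k)\<close>,
  which cuts the sum off at \<open>n div 3\<close>.\<close>

lemma fps_nth_path_gf:
  "fps_nth path_gf n = (\<Sum>k = 0..n div 3. 1 / (real k + 1) * real ((2 * k) choose k)
             * ((real n - 2 * real k - 1) gchoose (n - 3 * k)))"
proof -
  have nth: "fps_nth ((fps_X ^ 3 * inverse (1 - fps_X :: real fps)) ^ k) n =
      (if n < 3 * k then 0 else (real n - 2 * real k - 1) gchoose (n - 3 * k))" for k
  proof -
    have "(fps_X ^ 3 * inverse (1 - fps_X :: real fps)) ^ k =
        fps_X ^ (3 * k) * inverse (1 - fps_X) ^ k"
      by (simp add: power_mult_distrib power_mult)
    thus ?thesis
      by (simp add: fps_X_power_mult_nth fps_nth_inverse_one_minus_X_power of_nat_diff)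
  qed
  have "fps_nth path_gf n = (\<Sum>k = 0..n. fps_nth catalan_fps k *
      fps_nth ((fps_X ^ 3 * inverse (1 - fps_X)) ^ k) n)"
    by (simp add: path_gf_def fps_compose_nth)
  also have "\<dots> = (\<Sum>k = 0..n div 3. fps_nth catalan_fps k *
      fps_nth ((fps_X ^ 3 * inverse (1 - fps_X)) ^ k) n)"
    by (intro sum.mono_neutral_right) (auto simp: nth)
  also have "\<dots> = (\<Sum>k = 0..n div 3. 1 / (real k + 1) * real ((2 * k) choose k)
             * ((real n - 2 * real k - 1) gchoose (n - 3 * k)))"
    by (intro sum.cong refl) (auto simp: nth catalan_fps_def)
  finally show ?thesis .
qed

section \<open>The quadratic formula with a formal square root\<close>

definition discriminant_root :: "real fps" where
  "discriminant_root = 1 - fps_X - 2 * fps_X ^ 3 * path_gf"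

text \<open>Completing the square in \<open>x^3 S^2 - (1 - x) S + (1 - x) = 0\<close> gives the
  discriminant \<open>(1 - x) (1 - x - 4 x^3)\<close>, and
  \<open>1 - x - 4 x^3 = (1 - 2 x) (1 + x + 2 x^2)\<close>.\<close>

lemma discriminant_root_square:
  "discriminant_root ^ 2 = (1 - fps_X) * (1 - 2 * fps_X) * (1 + fps_X + 2 * fps_X ^ 2)"
proof -
  have "discriminant_root ^ 2 = (1 - fps_X) ^ 2 - 4 * fps_X ^ 3 *
      ((1 - fps_X) * path_gf - fps_X ^ 3 * path_gf ^ 2)"
    unfolding discriminant_root_def by (simp add: power2_eq_square power3_eq_cube algebra_simps)
  also have "\<dots> = (1 - fps_X) ^ 2 - 4 * fps_X ^ 3 * (1 - fps_X)"
    unfolding path_gf_quadratic by simp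
  finally show ?thesis by (simp add: power2_eq_square power3_eq_cube algebra_simps)
qed

text \<open>In \<open>(f - g) * (f + g) = 0\<close> the second factor has constant term
  \<open>2\<close>, so the first one vanishes.\<close>

lemma fps_square_root_unique:
  fixes f g :: "'a :: field_char_0 fps"
  assumes "f ^ 2 = g ^ 2" "fps_nth f 0 = 1" "fps_nth g 0 = 1"
  shows "f = g"
proof -
  have "fps_nth (f + g) 0 \<noteq> 0" using assms by simp
  hence "f + g \<noteq> 0" by (metis fps_zero_nth)
  moreover have "(f - g) * (f + g) = 0"
    using assms(1) by (simp add: power2_eq_square algebra_simps)
  ultimately show ?thesis by simp
qed

lemma fps_sqrt_square:
  assumes "fps_nth f 0 = 1"
  shows "fps_sqrt f ^ 2 = f" "fps_nth (fps_sqrt f) 0 = 1"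
proof -
  show "fps_sqrt f ^ 2 = f"
    using power_radical[of f root 1] assms by (simp add: fps_sqrt_def numeral_2_eq_2)
  show "fps_nth (fps_sqrt f) 0 = 1"
    using assms by (simp add: fps_sqrt_def numeral_2_eq_2)
qed

lemma fps_sqrt_discriminant:
  "fps_sqrt ((1 - fps_X) * (1 - 2 * fps_X) * (1 + fps_X + 2 * fps_X ^ 2)) = discriminant_root"
  by (rule fps_square_root_unique)
     (simp_all add: fps_sqrt_square discriminant_root_square, simp add: discriminant_root_def)

section \<open>Counting paths\<close>

text \<open>The series \<open>T\<close>. It equals \<open>fps_X * right_gf\<close>, which counts the
  paths that leave a circle of row \<open>1\<close> at its leftmost point by
  \<open>D_bar\<close>.\<close>

definition descent_gf :: "real fps" where
  "descent_gf = fps_X * (path_gf - 1 + fps_X * path_gf)"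

text \<open>This is \<open>(S - 1) / x\<close>, written through the functional equation to avoid a
  division by \<open>x\<close>. It counts paths from the point at 120 degrees in row
  \<open>0\<close>.\<close>

definition left_gf :: "real fps" where
  "left_gf = fps_X ^ 2 * inverse (1 - fps_X) * path_gf ^ 2"

definition right_gf :: "real fps" where
  "right_gf = path_gf - 1 + fps_X * path_gf"

text \<open>This and the next three identities mirror the choices of a first arc: 180 degrees in row
  \<open>0\<close>, 180 degrees in higher rows, 60 degrees, 120 degrees. Only here the empty path
  contributes a \<open>1\<close>.\<close>

lemma path_gf_split: "path_gf = 1 + fps_X * left_gf"
  using path_gf_eq by (simp add: left_gf_def power2_eq_square power3_eq_cube mult.assoc)

lemma descent_path_gf_split:
  "descent_gf * path_gf = fps_X * (descent_gf * left_gf) + fps_X * right_gf"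
proof -
  have "fps_X * (descent_gf * left_gf) = descent_gf * (path_gf - 1)"
    using path_gf_split by (metis add_diff_cancel_left' mult.left_commute)
  thus ?thesis by (simp add: descent_gf_def right_gf_def algebra_simps)
qed

lemma right_gf_split: "right_gf = fps_X * left_gf + fps_X * path_gf"
  using path_gf_split unfolding right_gf_def by (metis add_diff_cancel_left')

text \<open>Multiplication by \<open>(1 - x) x\<close> clears the denominators; then
  \<open>x^3 S^2\<close> is eliminated on the right by the quadratic equation for
  \<open>S\<close>.\<close>

lemma left_gf_split: "left_gf = fps_X * right_gf + fps_X * (descent_gf * path_gf)"
proof -
  have S: "path_gf ^ 2 * fps_X ^ 3 = (1 - fps_X) * (path_gf - 1)"
    using path_gf_quadratic by (simp add: algebra_simps)
  have "(1 - fps_X) * fps_X * left_gf = (1 - fps_X) * (path_gf - 1)"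
    using path_gf_split by (metis add_diff_cancel_left' mult.assoc)
  moreover have "(1 - fps_X) * fps_X * (fps_X * right_gf + fps_X * (descent_gf * path_gf)) =
     (1 - fps_X) * (fps_X ^ 2 * (path_gf - 1 + fps_X * path_gf) +
        (1 + fps_X) * (path_gf ^ 2 * fps_X ^ 3) - fps_X ^ 3 * path_gf)"
    by (simp add: right_gf_def descent_gf_def power2_eq_square power3_eq_cube algebra_simps)
  moreover have "fps_X ^ 2 * (path_gf - 1 + fps_X * path_gf) +
        (1 + fps_X) * (path_gf ^ 2 * fps_X ^ 3) - fps_X ^ 3 * path_gf = path_gf - 1"
    unfolding S by (simp add: power2_eq_square power3_eq_cube algebra_simps)
  ultimately have "(1 - fps_X) * fps_X * left_gf =
      (1 - fps_X) * fps_X * (fps_X * right_gf + fps_X * (descent_gf * path_gf))"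
    by metis
  moreover have "(1 - fps_X :: real fps) \<noteq> 0"
    using one_minus_X_inverse by force
  ultimately show ?thesis by simp
qed

section \<open>The linear recurrence and its solution\<close>

lemma card_paths_to_axis_Suc:
  assumes "finite (next_arcs z)"
    and "\<And>a. a \<in> next_arcs z \<Longrightarrow> finite (paths_to_axis n (pathfinish (arc_path a)))"
  shows "finite (paths_to_axis (Suc n) z)"
    and "card (paths_to_axis (Suc n) z) =
      (\<Sum>a\<in>next_arcs z. card (paths_to_axis n (pathfinish (arc_path a))))"
proof -
  show "finite (paths_to_axis (Suc n) z)"
    unfolding paths_to_axis_Suc using assms by simp
  have "card (paths_to_axis (Suc n) z) =
      (\<Sum>a\<in>next_arcs z. card ((#) a ` paths_to_axis n (pathfinish (arc_path a))))"
    unfolding paths_to_axis_Suc using assms by (intro card_UN_disjoint) auto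
  also have "\<dots> = (\<Sum>a\<in>next_arcs z. card (paths_to_axis n (pathfinish (arc_path a))))"
    by (intro sum.cong refl card_image) simp
  finally show "card (paths_to_axis (Suc n) z) = \<dots>" .
qed

text \<open>Finiteness is carried along because \<open>card\<close> is \<open>0\<close> on infinite
  sets.\<close>

definition has_path_count :: "nat \<Rightarrow> complex \<Rightarrow> real \<Rightarrow> bool" where
  "has_path_count n z c \<longleftrightarrow> finite (paths_to_axis n z) \<and> real (card (paths_to_axis n z)) = c"

lemma has_path_count_Suc1:
  assumes "next_arcs z = {a}" "has_path_count n (pathfinish (arc_path a)) c"
  shows "has_path_count (Suc n) z c"
  using assms card_paths_to_axis_Suc[of z n] by (simp add: has_path_count_def)

lemma has_path_count_Suc2:
  assumes "next_arcs z = {a, b}" "a \<noteq> b" "has_path_count n (pathfinish (arc_path a)) c"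
    "has_path_count n (pathfinish (arc_path b)) d"
  shows "has_path_count (Suc n) z (c + d)"
proof -
  have "finite (next_arcs z)" using assms by simp
  moreover have "finite (paths_to_axis n (pathfinish (arc_path x)))" if "x \<in> next_arcs z" for x
    using that assms by (auto simp: has_path_count_def)
  ultimately show ?thesis
    using assms card_paths_to_axis_Suc[of z n] by (simp add: has_path_count_def)
qed

text \<open>A path leaves a tangency point at angle \<open>180\<close>, \<open>120\<close> or \<open>60\<close> degrees of a circle in row
  \<open>m\<close>. Such a path has to descend by \<open>m\<close> rows, each of which contributes a factor
  \<open>descent_gf\<close> (first passage decomposition), and the hypotheses keep the point in the region
  \<open>x \<ge> 0\<close>.\<close>

lemma has_path_count_gf:
  fixes i :: int and m :: nat
  shows "0 \<le> 4 * i + 2 * int m \<Longrightarrow>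
      has_path_count n (lattice_point (4 * i + 2 * int m) (2 * int m))
        (fps_nth (descent_gf ^ m * path_gf) n)"
    and "0 \<le> 4 * i + 2 * int m \<Longrightarrow>
      has_path_count n (lattice_point (4 * i + 2 * int m + 1) (2 * int m + 1))
        (fps_nth (descent_gf ^ m * left_gf) n)"
    and "0 \<le> 2 + 4 * i + 2 * int m \<Longrightarrow>
      has_path_count n (lattice_point (4 * i + 2 * int m + 3) (2 * int m + 1))
        (fps_nth (descent_gf ^ m * right_gf) n)"
proof (induction n arbitrary: i m)
  case 0
  have eq0: "fps_nth path_gf 0 = 1" "fps_nth left_gf 0 = 0" "fps_nth right_gf 0 = 0"
    "fps_nth descent_gf 0 = 0"
    by (subst path_gf_split, simp) (subst left_gf_split, simp, subst right_gf_split, simp, simp add: descent_gf_def)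
  {
    case 1 thus ?case
      by (auto simp: has_path_count_def paths_to_axis_0 lattice_point_def eq0 fps_power_zeroth)
  next
    case 2
    \<comment> \<open>Points at 120 and 60 degrees have an odd ordinate index and thus never lie on
      the axis.\<close>
    have "2 * int m + 1 \<noteq> 0" by presburger
    hence "Im (lattice_point (4 * i + 2 * int m + 1) (2 * int m + 1)) \<noteq> 0"
      by (simp only: lattice_point_def complex.sel mult_eq_0_iff of_int_eq_0_iff) simp
    thus ?case by (simp add: has_path_count_def paths_to_axis_0 eq0)
  next
    case 3
    have "2 * int m + 1 \<noteq> 0" by presburger
    hence "Im (lattice_point (4 * i + 2 * int m + 3) (2 * int m + 1)) \<noteq> 0"
      by (simp only: lattice_point_def complex.sel mult_eq_0_iff of_int_eq_0_iff) simp
    thus ?case by (simp add: has_path_count_def paths_to_axis_0 eq0)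
  }
next
  case (Suc n)
  {
    case 1
    show ?case
    proof (cases m)
      case 0
      \<comment> \<open>The constant term \<open>1\<close>, the empty path, is invisible at index
        \<open>Suc n\<close>.\<close>
      have "fps_nth (descent_gf ^ m * path_gf) (Suc n) = fps_nth (descent_gf ^ m * left_gf) n"
        using 0 by (subst path_gf_split) simp
      moreover have "has_path_count n (pathfinish (arc_path (Packing_Arc i (int m) U)))
          (fps_nth (descent_gf ^ m * left_gf) n)"
        using Suc.IH(2)[OF 1] by (simp add: pathfinish_arc_path del: arc_path.simps)
      moreover have "next_arcs (lattice_point (4 * i + 2 * int m) (2 * int m)) =
          {Packing_Arc i (int m) U}"
        using next_arcs_C[of i "int m"] 1 0 by simp
      ultimately show ?thesis
        by (simp only: has_path_count_Suc1)
    next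
      case m: (Suc k)
      have "descent_gf ^ m * path_gf = descent_gf ^ k * (descent_gf * path_gf)"
        by (simp add: m mult.assoc mult.left_commute)
      also have "\<dots> = fps_X * (descent_gf ^ m * left_gf + descent_gf ^ k * right_gf)"
        unfolding descent_path_gf_split by (simp add: m algebra_simps)
      finally have "fps_nth (descent_gf ^ m * path_gf) (Suc n) =
          fps_nth (descent_gf ^ m * left_gf) n + fps_nth (descent_gf ^ k * right_gf) n"
        by simp
      moreover have "next_arcs (lattice_point (4 * i + 2 * int m) (2 * int m)) =
          {Packing_Arc i (int m) U, Packing_Arc i (int m) D_bar}"
        using next_arcs_C[of i "int m"] 1 m by auto
      moreover have "has_path_count n (pathfinish (arc_path (Packing_Arc i (int m) U)))
          (fps_nth (descent_gf ^ m * left_gf) n)"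
        using Suc.IH(2)[OF 1] by (simp add: pathfinish_arc_path del: arc_path.simps)
      \<comment> \<open>\<open>D_bar\<close> ends at 60 degrees of circle \<open>(i, k)\<close>, one
        row below, and \<open>2 + 4 i + 2 k = 4 i + 2 m\<close>.\<close>
      moreover have "has_path_count n (pathfinish (arc_path (Packing_Arc i (int m) D_bar)))
          (fps_nth (descent_gf ^ k * right_gf) n)"
        using Suc.IH(3)[of i k] 1 m by (simp add: pathfinish_arc_path algebra_simps del: arc_path.simps)
      ultimately show ?thesis
        by (simp only: has_path_count_Suc2 packing_arc.inject step.distinct simp_thms)
    qed
  next
    case 2
    have "descent_gf ^ m * left_gf = fps_X * (descent_gf ^ m * right_gf + descent_gf ^ Suc m * path_gf)"
      by (subst left_gf_split) (simp add: algebra_simps)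
    hence "fps_nth (descent_gf ^ m * left_gf) (Suc n) =
        fps_nth (descent_gf ^ m * right_gf) n + fps_nth (descent_gf ^ Suc m * path_gf) n"
      by simp
    moreover have "has_path_count n (pathfinish (arc_path (Packing_Arc i (int m) F)))
          (fps_nth (descent_gf ^ m * right_gf) n)"
      using Suc.IH(3)[of i m] 2 by (simp add: pathfinish_arc_path del: arc_path.simps)
    \<comment> \<open>The rightmost point of circle \<open>(i - 1, m + 1)\<close> is the leftmost
      point of circle \<open>(i, m + 1)\<close>.\<close>
    moreover have "has_path_count n (pathfinish (arc_path (Packing_Arc (i - 1) (int m + 1) U_bar)))
          (fps_nth (descent_gf ^ Suc m * path_gf) n)"
      using Suc.IH(1)[of i "Suc m"] 2
      by (simp add: pathfinish_arc_path algebra_simps del: arc_path.simps power_Suc)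
    moreover have "next_arcs (lattice_point (4 * i + 2 * int m + 1) (2 * int m + 1)) =
        {Packing_Arc i (int m) F, Packing_Arc (i - 1) (int m + 1) U_bar}"
      using next_arcs_A[of i "int m"] 2 by simp
    ultimately show ?case
      by (simp only: has_path_count_Suc2 packing_arc.inject step.distinct simp_thms)
  next
    case 3
    have "descent_gf ^ m * right_gf = fps_X * (descent_gf ^ m * path_gf + descent_gf ^ m * left_gf)"
      by (subst right_gf_split) (simp add: algebra_simps)
    hence "fps_nth (descent_gf ^ m * right_gf) (Suc n) =
        fps_nth (descent_gf ^ m * path_gf) n + fps_nth (descent_gf ^ m * left_gf) n"
      by simp
    moreover have "has_path_count n (pathfinish (arc_path (Packing_Arc i (int m) D)))
          (fps_nth (descent_gf ^ m * path_gf) n)"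
      using Suc.IH(1)[of "i + 1" m] 3
      by (simp add: pathfinish_arc_path algebra_simps del: arc_path.simps)
    moreover have "has_path_count n (pathfinish (arc_path (Packing_Arc i (int m + 1) F_bar)))
          (fps_nth (descent_gf ^ m * left_gf) n)"
      using Suc.IH(2)[of "i + 1" m] 3
      by (simp add: pathfinish_arc_path algebra_simps del: arc_path.simps)
    moreover have "next_arcs (lattice_point (4 * i + 2 * int m + 3) (2 * int m + 1)) =
        {Packing_Arc i (int m) D, Packing_Arc i (int m + 1) F_bar}"
      using next_arcs_B[of i "int m"] 3 by simp
    ultimately show ?case
      by (simp only: has_path_count_Suc2 packing_arc.inject step.distinct simp_thms)
  }
qed

lemma packing_gf_eq: "packing_gf = path_gf"
proof (rule fps_ext)
  fix n
  have "lattice_point 0 0 = 0" by (simp add: lattice_point_def complex_eq_iff)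
  thus "fps_nth packing_gf n = fps_nth path_gf n"
    using has_path_count_gf(1)[of 0 0 n]
    by (simp add: packing_gf_def packing_paths_eq has_path_count_def)
qed

section \<open>Asymptotics\<close>

definition complex_fps :: "real fps \<Rightarrow> complex fps" where
  "complex_fps f = Abs_fps (\<lambda>n. complex_of_real (fps_nth f n))"

lemma complex_fps_mult: "complex_fps (f * g) = complex_fps f * complex_fps g"
  by (rule fps_ext) (simp add: complex_fps_def fps_mult_nth)

lemma fps_conv_radius_complex_fps: "fps_conv_radius (complex_fps f) = fps_conv_radius f"
proof -
  have "conv_radius (\<lambda>n. norm (complex_of_real (fps_nth f n))) = conv_radius (\<lambda>n. norm (fps_nth f n))"
    by simp
  moreover have "fps_nth (complex_fps f) = (\<lambda>n. complex_of_real (fps_nth f n))"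
    by (simp add: complex_fps_def fun_eq_iff)
  ultimately show ?thesis unfolding fps_conv_radius_def by (simp only: conv_radius_norm)
qed

lemma fps_conv_radius_mult_greater:
  assumes "r < fps_conv_radius f" "r < fps_conv_radius g"
  shows "r < fps_conv_radius (f * g)"
  using assms fps_conv_radius_mult[of f g] by (meson less_le_trans min_less_iff_conj)

lemma fps_conv_radius_binomial_half_compose:
  fixes c :: complex
  assumes "c \<noteq> 0"
  shows "fps_conv_radius (fps_binomial (1 / 2) oo (fps_const c * fps_X)) = 1 / ereal (norm c)"
proof -
  \<comment> \<open>For a natural exponent the binomial series would be a polynomial with infinite
    radius.\<close>
  have half: "(1 / 2 :: complex) \<notin> \<nat>"
  proof
    assume "(1 / 2 :: complex) \<in> \<nat>"
    then obtain k where "(1 / 2 :: complex) = of_nat k" by (auto elim: Nats_cases)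
    hence "Re (1 / 2) = Re (of_nat k)" by (rule arg_cong)
    hence "real (2 * k) = real 1" by simp
    hence "2 * k = 1" by (simp only: of_nat_eq_iff)
    thus False by presburger
  qed
  have "fps_conv_radius (fps_binomial (1 / 2) oo (fps_const c * fps_X)) =
      conv_radius (\<lambda>n. c ^ n * (1 / 2 gchoose n))"
    unfolding fps_compose_linear fps_conv_radius_def by simp
  also have "\<dots> = conv_radius (\<lambda>n. (1 / 2 :: complex) gchoose n) / ereal (norm c)"
    using assms by (subst conv_radius_mult_power) auto
  finally show ?thesis using half by (simp add: conv_radius_gchoose)
qed

text \<open>Over the complex numbers \<open>1 + x + 2 x\<^sup>2\<close> splits into linear factors with roots of modulus
  \<open>1 / sqrt 2\<close>, so the square root is a product of three binomial series. Any radius strictly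
  between \<open>1 / 2\<close> and \<open>1 / sqrt 2\<close> would do.\<close>

lemma fps_conv_radius_regular_factor:
  fixes f :: "real fps"
  assumes "f ^ 2 = (1 - fps_X) * (1 + fps_X + 2 * fps_X ^ 2)" "fps_nth f 0 = 1"
  shows "fps_conv_radius f > ereal (3 / 5)"
proof -
  \<comment> \<open>Chosen so that \<open>1 + x + 2 x^2 = (1 + a x) (1 + cnj a x)\<close>.\<close>
  define a where "a = Complex (1 / 2) (sqrt 7 / 2)"
  let ?b = "\<lambda>c. fps_binomial (1 / 2) oo (fps_const c * fps_X) :: complex fps"
  have norm_a: "norm a = sqrt 2" "norm (cnj a) = sqrt 2"
    by (simp_all add: a_def cmod_def power_divide)
  have nz: "a \<noteq> 0" "cnj a \<noteq> 0" using norm_a by auto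
  have ac: "a + cnj a = 1" "a * cnj a = 2"
    by (simp_all add: a_def complex_eq_iff power2_eq_square)
  have "(?b (- 1) * ?b a * ?b (cnj a)) ^ 2 =
      (1 + fps_const (- 1) * fps_X) * (1 + fps_const a * fps_X) * (1 + fps_const (cnj a) * fps_X)"
    by (simp only: power_mult_distrib fps_binomial_half_compose_square)
  also have "\<dots> = (1 - fps_X) * (1 + fps_const (a + cnj a) * fps_X + fps_const (a * cnj a) * fps_X ^ 2)"
    by (simp add: algebra_simps power2_eq_square flip: fps_const_add fps_const_mult)
  also have "\<dots> = complex_fps (f ^ 2)"
    unfolding ac assms complex_fps_mult
    by (rule arg_cong2[of _ _ _ _ "(*)"])
       (rule fps_ext; simp add: complex_fps_def numeral_fps_const fps_X_power_nth)+
  also have "\<dots> = complex_fps f ^ 2"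
    by (simp add: power2_eq_square complex_fps_mult)
  finally have square: "complex_fps f ^ 2 = (?b (- 1) * ?b a * ?b (cnj a)) ^ 2" ..
  have "complex_fps f = ?b (- 1) * ?b a * ?b (cnj a)"
    by (rule fps_square_root_unique[OF square]) (simp_all add: complex_fps_def assms(2))
  hence radius: "fps_conv_radius f = fps_conv_radius (?b (- 1) * ?b a * ?b (cnj a))"
    using fps_conv_radius_complex_fps[of f] by simp
  have "sqrt 2 < 5 / 3" by (rule real_less_lsqrt) (auto simp: power2_eq_square)
  hence "ereal (3 / 5) < 1" "ereal (3 / 5) < 1 / ereal (sqrt 2)"
    by (simp_all add: one_ereal_def field_simps)
  moreover have "fps_conv_radius (?b (- 1)) = 1"
    by (subst fps_conv_radius_binomial_half_compose) (simp_all add: one_ereal_def)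
  moreover have "fps_conv_radius (?b a) = 1 / ereal (sqrt 2)"
    "fps_conv_radius (?b (cnj a)) = 1 / ereal (sqrt 2)"
    using nz norm_a by (simp_all only: fps_conv_radius_binomial_half_compose not_False_eq_True)
  ultimately show ?thesis
    unfolding radius by (intro fps_conv_radius_mult_greater) simp_all
qed

text \<open>Dominated convergence for series: each fixed \<open>k\<close> contributes
  \<open>c * v k\<close> in the limit, and the weighted summability of \<open>v\<close> supplies the
  majorant.\<close>

lemma convolution_asymptotics:
  fixes u v :: "nat \<Rightarrow> real"
  assumes u: "(\<lambda>n. u n * real n powr (3 / 2)) \<longlonglongrightarrow> c"
    and v: "summable (\<lambda>k. \<bar>v k\<bar> * (real k + 1) powr (3 / 2))"
  shows "(\<lambda>n. (\<Sum>k\<le>n. v k * u (n - k)) * real n powr (3 / 2)) \<longlonglongrightarrow> c * suminf v"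
proof -
  define a where "a = (\<lambda>k n. if k \<le> n then v k * u (n - k) * real n powr (3 / 2) else 0)"
  \<comment> \<open>With \<open>n + 1\<close> in place of \<open>n\<close> the weight is positive at
    \<open>n = 0\<close>, so the bound also controls \<open>u 0\<close>.\<close>
  have "(\<lambda>n. u n * (real n + 1) powr (3 / 2)) \<longlonglongrightarrow> c"
  proof (rule Lim_transform_eventually)
    have "(\<lambda>n::nat. ((real n + 1) / real n) powr (3 / 2)) \<longlonglongrightarrow> 1" by real_asymp
    from tendsto_mult[OF u this]
    show "(\<lambda>n. u n * real n powr (3 / 2) * ((real n + 1) / real n) powr (3 / 2)) \<longlonglongrightarrow> c" by simp
    show "\<forall>\<^sub>F n in sequentially. u n * real n powr (3 / 2) * ((real n + 1) / real n) powr (3 / 2) =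
        u n * (real n + 1) powr (3 / 2)"
      using eventually_gt_at_top[of 0] by eventually_elim (simp add: powr_divide)
  qed
  hence "Bseq (\<lambda>n. u n * (real n + 1) powr (3 / 2))"
    by (intro convergent_imp_Bseq) (auto simp: convergent_def)
  then obtain B where B: "B > 0" "\<And>n. \<bar>u n * (real n + 1) powr (3 / 2)\<bar> \<le> B"
    by (auto simp: Bseq_def)
  have bound: "norm (a k n) \<le> B * (\<bar>v k\<bar> * (real k + 1) powr (3 / 2))" for k n
  proof (cases "k \<le> n")
    case True
    define j where "j = n - k"
    have n: "n = j + k" using True by (simp add: j_def)
    \<comment> \<open>With \<open>n = j + k\<close>, the estimate
      \<open>n \<le> (j + 1) (k + 1)\<close> separates the two weights.\<close>
    have "real n powr (3 / 2) \<le> ((real j + 1) * (real k + 1)) powr (3 / 2)"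
      by (intro powr_mono2) (auto simp: n algebra_simps)
    hence "\<bar>u j\<bar> * real n powr (3 / 2) \<le> \<bar>u j\<bar> * ((real j + 1) powr (3 / 2) * (real k + 1) powr (3 / 2))"
      by (intro mult_left_mono) (simp_all add: powr_mult)
    also have "\<dots> = \<bar>u j * (real j + 1) powr (3 / 2)\<bar> * (real k + 1) powr (3 / 2)"
      by (simp add: abs_mult)
    also have "\<dots> \<le> B * (real k + 1) powr (3 / 2)"
      by (intro mult_right_mono B) simp
    finally have "\<bar>v k\<bar> * (\<bar>u j\<bar> * real n powr (3 / 2)) \<le> \<bar>v k\<bar> * (B * (real k + 1) powr (3 / 2))"
      by (intro mult_left_mono) auto
    thus ?thesis using True by (simp add: a_def abs_mult mult_ac flip: j_def)
  qed (use B(1) in \<open>simp add: a_def\<close>)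
  have lim: "a k \<longlonglongrightarrow> v k * c" for k
  proof -
    have "(\<lambda>n. u n * real (n + k) powr (3 / 2)) \<longlonglongrightarrow> c"
    proof (rule Lim_transform_eventually)
      have "(\<lambda>n::nat. ((real n + real k) / real n) powr (3 / 2)) \<longlonglongrightarrow> 1" by real_asymp
      from tendsto_mult[OF u this]
      show "(\<lambda>n. u n * real n powr (3 / 2) * ((real n + real k) / real n) powr (3 / 2)) \<longlonglongrightarrow> c" by simp
      show "\<forall>\<^sub>F n in sequentially. u n * real n powr (3 / 2) * ((real n + real k) / real n) powr (3 / 2) =
          u n * real (n + k) powr (3 / 2)"
        using eventually_gt_at_top[of 0] by eventually_elim (simp add: powr_divide)
    qed
    hence "(\<lambda>n. v k * (u n * real (n + k) powr (3 / 2))) \<longlonglongrightarrow> v k * c"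
      by (intro tendsto_mult tendsto_const)
    hence "(\<lambda>n. a k (n + k)) \<longlonglongrightarrow> v k * c"
      by (simp add: a_def mult.assoc)
    thus ?thesis by (rule LIMSEQ_offset)
  qed
  have "(\<lambda>n. \<Sum>k. a k n) \<longlonglongrightarrow> (\<Sum>k. v k * c)"
    using tannerys_theorem[OF lim, where M = "\<lambda>k. B * (\<bar>v k\<bar> * (real k + 1) powr (3 / 2))"] bound v
    by (auto simp: case_prod_unfold intro: summable_mult)
  moreover have "(\<Sum>k. a k n) = (\<Sum>k\<le>n. v k * u (n - k)) * real n powr (3 / 2)" for n
  proof -
    have "(\<Sum>k. a k n) = (\<Sum>k\<le>n. a k n)"
      by (intro suminf_finite) (auto simp: a_def)
    thus ?thesis by (simp add: a_def sum_distrib_right)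
  qed
  moreover have "(\<Sum>k. v k * c) = c * suminf v"
  proof -
    have "summable v"
    proof (rule summable_comparison_test'[OF v])
      fix k :: nat
      have "1 \<le> (real k + 1) powr (3 / 2)" by (intro ge_one_powr_ge_zero) auto
      thus "norm (v k) \<le> \<bar>v k\<bar> * (real k + 1) powr (3 / 2)"
        using mult_left_mono[of 1 "(real k + 1) powr (3 / 2)" "\<bar>v k\<bar>"] by simp
    qed
    thus ?thesis using suminf_mult2[of v c] by (simp add: mult.commute)
  qed
  ultimately show ?thesis by simp
qed

text \<open>The limit is \<open>1 / Gamma (- 1 / 2)\<close>, and
  \<open>Gamma (1 / 2) = sqrt pi\<close> gives
  \<open>Gamma (- 1 / 2) = - 2 * sqrt pi\<close>.\<close>

lemma gbinomial_half_asymptotics: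
  "(\<lambda>n. ((1 / 2 :: real) gchoose n) * (- 1) ^ n * real n powr (3 / 2)) \<longlonglongrightarrow> - 1 / (2 * sqrt pi)"
proof -
  have "(- 1 / 2 :: real) \<notin> \<int>\<^sub>\<le>\<^sub>0"
  proof
    assume "(- 1 / 2 :: real) \<in> \<int>\<^sub>\<le>\<^sub>0"
    then obtain k where "- 1 / 2 = - real k" by (elim nonpos_Ints_cases')
    hence "real (2 * k) = real 1" by simp
    hence "2 * k = 1" by (simp only: of_nat_eq_iff)
    thus False by presburger
  qed
  hence "Gamma (- 1 / 2 :: real) = - 2 * sqrt pi"
    using Gamma_plus1[of "- 1 / 2 :: real"] Gamma_one_half_real by simp
  hence lim: "(\<lambda>n. ((1 / 2 :: real) gchoose n) / ((- 1) ^ n / exp ((1 / 2 + 1) * of_real (ln (real n)))))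
      \<longlonglongrightarrow> - 1 / (2 * sqrt pi)"
    using gbinomial_asymptotic[of "1 / 2 :: real"] by (simp add: field_simps)
  show ?thesis
  proof (rule Lim_transform_eventually[OF lim])
    show "\<forall>\<^sub>F n in sequentially. ((1 / 2 :: real) gchoose n) / ((- 1) ^ n / exp ((1 / 2 + 1) * of_real (ln (real n)))) =
        ((1 / 2 :: real) gchoose n) * (- 1) ^ n * real n powr (3 / 2)"
      using eventually_gt_at_top[of 0]
    proof eventually_elim
      case (elim n)
      have "(- 1 :: real) ^ n = 1 \<or> (- 1 :: real) ^ n = - 1" by (cases "even n") auto
      thus ?case using elim by (auto simp: powr_def)
    qed
  qed
qed

text \<open>Writing \<open>1 / 2 = (3 / 5) * (5 / 6)\<close>, the powers of \<open>5 / 6\<close>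
  absorb the weight, while \<open>3 / 5\<close> lies inside the disc of convergence.\<close>

lemma summable_regular_factor:
  fixes f :: "real fps"
  assumes "fps_conv_radius f > ereal (3 / 5)"
  shows "summable (\<lambda>k. \<bar>fps_nth f k * (1 / 2) ^ k\<bar> * (real k + 1) powr (3 / 2))"
proof -
  have "(\<lambda>k::nat. (5 / 6) ^ k * (real k + 1) powr (3 / 2)) \<longlonglongrightarrow> (0 :: real)" by real_asymp
  hence "Bseq (\<lambda>k::nat. (5 / 6) ^ k * (real k + 1) powr (3 / 2) :: real)"
    by (intro convergent_imp_Bseq) (auto simp: convergent_def)
  then obtain B where B: "\<And>k::nat. \<bar>(5 / 6) ^ k * (real k + 1) powr (3 / 2)\<bar> \<le> B"
    by (auto simp: Bseq_def)
  have "ereal (norm (3 / 5 :: real)) < fps_conv_radius f"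
    using assms by simp
  hence "summable (\<lambda>k. norm (fps_nth f k * (3 / 5) ^ k))"
    by (rule norm_summable_fps)
  hence "summable (\<lambda>k. norm (fps_nth f k * (3 / 5) ^ k) * B)"
    by (rule summable_mult2)
  thus ?thesis
  proof (rule summable_comparison_test')
    fix k :: nat
    have "(1 / 2 :: real) ^ k = (3 / 5) ^ k * (5 / 6) ^ k"
      by (simp flip: power_mult_distrib)
    hence "\<bar>fps_nth f k * (1 / 2) ^ k\<bar> * (real k + 1) powr (3 / 2) =
        norm (fps_nth f k * (3 / 5) ^ k) * \<bar>(5 / 6) ^ k * (real k + 1) powr (3 / 2)\<bar>"
      by (simp add: abs_mult)
    also have "\<dots> \<le> norm (fps_nth f k * (3 / 5) ^ k) * B"
      by (intro mult_left_mono B) simp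
    finally show "norm (\<bar>fps_nth f k * (1 / 2) ^ k\<bar> * (real k + 1) powr (3 / 2)) \<le>
        norm (fps_nth f k * (3 / 5) ^ k) * B" by simp
  qed
qed

lemma path_gf_asymptotics:
  assumes "\<And>n. 0 \<le> fps_nth path_gf n"
  shows "(\<lambda>n. fps_nth path_gf n) \<sim>[at_top] (\<lambda>n. 2 ^ (n + 1) / (sqrt pi * real n powr (3 / 2)))"
proof -
  \<comment> \<open>The factor \<open>V\<close>. Below, \<open>u\<close> and \<open>v\<close> are
    the coefficients of \<open>sqrt (1 - 2 x)\<close> and \<open>V\<close> rescaled to the
    singularity at \<open>1 / 2\<close>, so that \<open>suminf v\<close> is
    \<open>V(1/2)\<close>.\<close>
  define f where "f = fps_sqrt ((1 - fps_X) * (1 + fps_X + 2 * fps_X ^ 2))"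
  have f: "f ^ 2 = (1 - fps_X) * (1 + fps_X + 2 * fps_X ^ 2)" "fps_nth f 0 = 1"
    unfolding f_def by (rule fps_sqrt_square, simp)+
  have radius: "fps_conv_radius f > ereal (3 / 5)"
    by (rule fps_conv_radius_regular_factor[OF f])
  define u :: "nat \<Rightarrow> real" where "u = (\<lambda>n. (1 / 2 gchoose n) * (- 1) ^ n)"
  define v where "v = (\<lambda>k. fps_nth f k * (1 / 2) ^ k)"

  have root: "discriminant_root = f * (fps_binomial (1 / 2) oo (fps_const (- 2) * fps_X))"
  proof (rule fps_square_root_unique)
    have "(1 + fps_const (- 2) * fps_X :: real fps) = 1 - 2 * fps_X"
      by (simp add: numeral_fps_const)
    thus "discriminant_root ^ 2 = (f * (fps_binomial (1 / 2) oo (fps_const (- 2) * fps_X))) ^ 2"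
      unfolding power_mult_distrib fps_binomial_half_compose_square f discriminant_root_square
      by (simp only: mult_ac)
  qed (simp_all add: f discriminant_root_def)
  have root_nth: "fps_nth discriminant_root n = 2 ^ n * (\<Sum>k\<le>n. v k * u (n - k))" for n
  proof -
    have "fps_nth f k * ((- 2) ^ (n - k) * (1 / 2 gchoose (n - k))) = 2 ^ n * (v k * u (n - k))"
      if "k \<le> n" for k
    proof -
      have "(2 :: real) ^ n = 2 ^ k * 2 ^ (n - k)" using that by (simp flip: power_add)
      moreover have "(- 2 :: real) ^ (n - k) = (- 1) ^ (n - k) * 2 ^ (n - k)"
        by (simp flip: power_mult_distrib)
      ultimately show ?thesis by (simp add: u_def v_def power_divide)
    qed
    thus ?thesis
      unfolding root fps_mult_nth fps_compose_linear
      by (simp add: sum_distrib_left atMost_atLeast0)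
  qed

  have lim: "(\<lambda>n. (\<Sum>k\<le>n. v k * u (n - k)) * real n powr (3 / 2)) \<longlonglongrightarrow> - 1 / (2 * sqrt pi) * suminf v"
    using gbinomial_half_asymptotics summable_regular_factor[OF radius]
    by (intro convolution_asymptotics) (simp_all add: u_def v_def)

  have "norm (1 / 2 :: real) < fps_conv_radius f"
    using radius by (rule le_less_trans[rotated]) simp
  hence "eval_fps (f ^ 2) (1 / 2) = eval_fps f (1 / 2) ^ 2"
    by (simp add: eval_fps_power)
  \<comment> \<open>The value is \<open>(1 - 1/2) (1 + 1/2 + 1/2) = 1\<close>.\<close>
  moreover have "eval_fps (f ^ 2) (1 / 2) = 1"
  proof -
    have "f ^ 2 = fps_of_poly ([:1, -1:] * [:1, 1, 2:])"
      unfolding f fps_of_poly_mult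
      by (simp add: fps_of_poly_pCons numeral_fps_const power2_eq_square algebra_simps)
    thus ?thesis by (simp del: mult_pCons_left mult_pCons_right)
  qed
  moreover have "eval_fps f (1 / 2) = suminf v"
    by (simp add: eval_fps_def v_def)
  ultimately have sum_cases: "suminf v = 1 \<or> suminf v = - 1"
    by (simp add: power2_eq_1_iff)

  define g where "g = (\<lambda>n. fps_nth path_gf n * (sqrt pi * real n powr (3 / 2)) / 2 ^ (n + 1))"
  have "g \<longlonglongrightarrow> suminf v"
  proof (rule Lim_transform_eventually)
    \<comment> \<open>The coefficient of \<open>x^n\<close> in \<open>S\<close> sits at
      \<open>x^(n + 3)\<close> in the discriminant root; this ratio compensates the shift, and
      \<open>- 2 * sqrt pi\<close> cancels the limit constant of \<open>u\<close>.\<close>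
    have "(\<lambda>n::nat. (real n / real (n + 3)) powr (3 / 2)) \<longlonglongrightarrow> 1" by real_asymp
    from tendsto_mult[OF tendsto_mult[OF LIMSEQ_ignore_initial_segment[OF lim, of 3] this]
        tendsto_const[of "- 2 * sqrt pi"]]
    show "(\<lambda>n. (\<Sum>k\<le>n + 3. v k * u (n + 3 - k)) * real (n + 3) powr (3 / 2) *
        (real n / real (n + 3)) powr (3 / 2) * (- 2 * sqrt pi)) \<longlonglongrightarrow> suminf v"
      by simp
    show "\<forall>\<^sub>F n in sequentially. (\<Sum>k\<le>n + 3. v k * u (n + 3 - k)) * real (n + 3) powr (3 / 2) *
        (real n / real (n + 3)) powr (3 / 2) * (- 2 * sqrt pi) = g n"
      using eventually_gt_at_top[of 0]
    proof eventually_elim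
      case (elim n)
      have shift: "2 * fps_X ^ 3 * path_gf = fps_X ^ 3 * (fps_const 2 * path_gf)"
        by (simp add: numeral_fps_const)
      have "fps_nth (2 * fps_X ^ 3 * path_gf) (n + 3) = 2 * fps_nth path_gf n"
        unfolding shift by (simp add: fps_X_power_mult_nth)
      hence "fps_nth discriminant_root (n + 3) = - 2 * fps_nth path_gf n"
        using elim by (simp add: discriminant_root_def)
      hence "- 2 * fps_nth path_gf n = 2 ^ (n + 3) * (\<Sum>k\<le>n + 3. v k * u (n + 3 - k))"
        using root_nth[of "n + 3"] by simp
      hence "fps_nth path_gf n = - (2 ^ (n + 2)) * (\<Sum>k\<le>n + 3. v k * u (n + 3 - k))"
        by (simp add: power_add)
      thus ?case
        by (simp add: g_def powr_divide power_add)
    qed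
  qed
  \<comment> \<open>Nonnegative coefficients exclude the value \<open>- 1\<close> for the
    limit.\<close>
  moreover have "0 \<le> g n" for n
    using assms by (simp add: g_def)
  ultimately have "0 \<le> suminf v"
    by (intro LIMSEQ_le_const) auto
  hence "suminf v = 1" using sum_cases by auto
  with \<open>g \<longlonglongrightarrow> suminf v\<close> have "g \<longlonglongrightarrow> 1" by simp
  thus ?thesis
  proof (intro asymp_equivI', elim Lim_transform_eventually)
    show "\<forall>\<^sub>F n in sequentially. g n = fps_nth path_gf n / (2 ^ (n + 1) / (sqrt pi * real n powr (3 / 2)))"
      by (simp add: g_def)
  qed
qed

theorem corollary8:
  shows
    "fps_to_fls packing_gf =
       fps_to_fls (1 - fps_X - fps_sqrt ((1 - fps_X) * (1 - 2 * fps_X) * (1 + fps_X + 2 * fps_X ^ 2)))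
         / fps_to_fls (2 * fps_X ^ 3)
     \<and> fps_nth packing_gf 0 = 1
     \<and> (\<forall>n::nat. fps_nth packing_gf n =
          (\<Sum>k = 0..n div 3. 1 / (real k + 1) * real ((2 * k) choose k)
             * ((real n - 2 * real k - 1) gchoose (n - 3 * k))))
     \<and> (\<lambda>n. fps_nth packing_gf n) \<sim>[at_top]
          (\<lambda>n. 2 ^ (n + 1) / (sqrt pi * real n powr (3 / 2)))"
proof (intro conjI allI)
  \<comment> \<open>The quotient is taken among Laurent series, where \<open>2 x^3\<close> is
    invertible; it suffices to verify the identity multiplied by \<open>2 x^3\<close>.\<close>
  have "fps_to_fls (1 - fps_X - discriminant_root) = fps_to_fls (2 * fps_X ^ 3) * fps_to_fls packing_gf"
    by (simp add: discriminant_root_def packing_gf_eq flip: fls_times_fps_to_fls)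
  moreover have "fps_to_fls (2 * fps_X ^ 3 :: real fps) \<noteq> 0"
    by (simp only: fps_to_fls_eq_0_iff) simp
  ultimately show "fps_to_fls packing_gf =
      fps_to_fls (1 - fps_X - fps_sqrt ((1 - fps_X) * (1 - 2 * fps_X) * (1 + fps_X + 2 * fps_X ^ 2)))
        / fps_to_fls (2 * fps_X ^ 3)"
    unfolding fps_sqrt_discriminant by (metis nonzero_mult_div_cancel_left)
  show "fps_nth packing_gf 0 = 1"
    unfolding packing_gf_eq by (subst path_gf_split) simp
  show "fps_nth packing_gf n =
      (\<Sum>k = 0..n div 3. 1 / (real k + 1) * real ((2 * k) choose k)
         * ((real n - 2 * real k - 1) gchoose (n - 3 * k)))" for n
    unfolding packing_gf_eq by (rule fps_nth_path_gf)
  show "(\<lambda>n. fps_nth packing_gf n) \<sim>[at_top] (\<lambda>n. 2 ^ (n + 1) / (sqrt pi * real n powr (3 / 2)))"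
    unfolding packing_gf_eq
    by (rule path_gf_asymptotics) (simp add: packing_gf_def flip: packing_gf_eq)
qed

end
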